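(* Let $p$ be an odd prime, let $G$ be a quasi-powerful $p$-group with $d(G)=r$ and let $L\le G$ be a subgroup. Then $d(L)\le \frac{1}{2}r(r+3)$.
   Context: For an odd prime $p$, a finite $p$-group $G$ is powerful if $[G,G]\le G^{p}$, and $G$ is quasi-powerful if $G/Z(G)$ is powerful. $d(X)$ denotes the minimal number of generators of a group $X$. *)

theory Defs
  imports "HOL-Algebra.Algebra"
begin

definition group_center :: "('a, 'b) monoid_scheme \<Rightarrow> 'a set" where
  "group_center G = {z \<in> carrier G. \<forall>g \<in> carrier G. z \<otimes>\<^bsub>G\<^esub> g = g \<otimes>\<^bsub>G\<^esub> z}"

definition pow_subgroup :: "('a, 'b) monoid_scheme \<Rightarrow> nat \<Rightarrow> 'a set" where
  "pow_subgroup G p = generate G {g [^]\<^bsub>G\<^esub> p | g. g \<in> carrier G}"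

definition p_group :: "nat \<Rightarrow> ('a, 'b) monoid_scheme \<Rightarrow> bool" where
  "p_group p G \<longleftrightarrow> group G \<and> finite (carrier G) \<and> (\<exists>n. order G = p ^ n)"

definition powerful :: "nat \<Rightarrow> ('a, 'b) monoid_scheme \<Rightarrow> bool" where
  "powerful p G \<longleftrightarrow> p_group p G \<and> derived G (carrier G) \<subseteq> pow_subgroup G p"

definition quasi_powerful :: "nat \<Rightarrow> ('a, 'b) monoid_scheme \<Rightarrow> bool" where
  "quasi_powerful p G \<longleftrightarrow> p_group p G \<and> powerful p (G Mod group_center G)"

definition min_gens :: "('a, 'b) monoid_scheme \<Rightarrow> nat" where
  "min_gens G = (LEAST n. \<exists>S. S \<subseteq> carrier G \<and> finite S \<and> card S = n \<and> generate G S = carrier G)"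

end

theory Submission
  imports Defs
begin

text \<open>
  Let \<open>Z\<close> be the center and \<open>D\<close> the derived subgroup of \<open>G\<close>. Along the chain
  \<open>L \<ge> L \<inter> Z \<ge> L \<inter> Z \<inter> D\<close> the sections are subgroups of \<open>G/Z\<close>, of \<open>G/D\<close> and of \<open>D\<close>, all three of
  which are powerful; the first two have at most \<open>r\<close> generators, and \<open>D\<close> is generated modulo
  \<open>D\<^sup>p\<close> by the \<open>r (r - 1) / 2\<close> commutators of a generating set. As subgroups of powerful
  \<open>p\<close>-groups need no more generators than the group, \<open>L\<close> has at most
  \<open>r + r + r (r - 1) / 2 = r (r + 3) / 2\<close> generators.

  For the statement on subgroups \<open>H\<close> of powerful groups, consider the series \<open>P\<^sub>i\<^sub>+\<^sub>1 = P\<^sub>i\<^sup>p\<close>. The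
  \<open>p\<close>-th power map induces epimorphisms \<open>P\<^sub>i/P\<^sub>i\<^sub>+\<^sub>1 \<rightarrow> P\<^sub>i\<^sub>+\<^sub>1/P\<^sub>i\<^sub>+\<^sub>2\<close>, so the generators already chosen for
  the image of \<open>H \<inter> P\<^sub>i\<close> in \<open>P\<^sub>i/P\<^sub>i\<^sub>+\<^sub>1\<close> cover, through their \<open>p\<close>-th powers, a part of the next
  layer; the numbers of new generators needed in the layers telescope to the rank of \<open>P\<^sub>1/P\<^sub>2\<close>.
\<close>

subsection \<open>Powers of products and finite p-groups\<close>

text \<open>Moving every b to the right past the later a's produces one factor z per exchange, hence
  0 + 1 + ... + (n - 1) of them in the n-th power. For n = p = 2k + 1 this exponent is p * k, so the
  z's cancel. This is where the oddness of \<open>p\<close> enters.\<close>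

lemma (in group) pow_mult_class_two:
  assumes "a \<in> carrier G" "b \<in> carrier G" "z \<in> carrier G"
    and ba: "b \<otimes> a = a \<otimes> b \<otimes> z" and za: "z \<otimes> a = a \<otimes> z" and zb: "z \<otimes> b = b \<otimes> z"
    and zp: "z [^] p = \<one>" and "odd (p::nat)"
  shows "(a \<otimes> b) [^] p = a [^] p \<otimes> b [^] p"
proof -
  note [simp] = assms(1-3)
  have bna: "b [^] n \<otimes> a = a \<otimes> b [^] n \<otimes> z [^] n" for n :: nat
  proof (induction n)
    case (Suc n)
    have "b [^] Suc n \<otimes> a = b [^] n \<otimes> (a \<otimes> b \<otimes> z)"
      using ba by (simp add: m_assoc)
    also have "\<dots> = a \<otimes> b [^] n \<otimes> z [^] n \<otimes> (b \<otimes> z)"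
      using Suc by (simp add: m_assoc [symmetric])
    also have "\<dots> = a \<otimes> b [^] n \<otimes> (z [^] n \<otimes> b) \<otimes> z"
      by (simp add: m_assoc)
    also have "\<dots> = a \<otimes> b [^] n \<otimes> (b \<otimes> z [^] n) \<otimes> z"
      using group_commutes_pow[OF zb] by simp
    finally show ?case by (simp add: m_assoc)
  qed simp
  have "(a \<otimes> b) [^] n = a [^] n \<otimes> b [^] n \<otimes> z [^] (\<Sum>{..<n})" for n :: nat
  proof (induction n)
    case (Suc n)
    let ?t = "\<Sum>{..<n}"
    have "(a \<otimes> b) [^] Suc n = a [^] n \<otimes> b [^] n \<otimes> (z [^] ?t \<otimes> a) \<otimes> b"
      using Suc by (simp add: m_assoc)
    also have "\<dots> = a [^] n \<otimes> (b [^] n \<otimes> a) \<otimes> (z [^] ?t \<otimes> b)"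
      using group_commutes_pow[OF za] by (simp add: m_assoc)
    also have "\<dots> = a [^] n \<otimes> (a \<otimes> b [^] n \<otimes> z [^] n) \<otimes> (b \<otimes> z [^] ?t)"
      using group_commutes_pow[OF zb] bna by simp
    also have "\<dots> = a [^] Suc n \<otimes> b [^] n \<otimes> (z [^] n \<otimes> b) \<otimes> z [^] ?t"
      by (simp add: m_assoc)
    also have "\<dots> = a [^] Suc n \<otimes> b [^] n \<otimes> (b \<otimes> z [^] n) \<otimes> z [^] ?t"
      using group_commutes_pow[OF zb] by simp
    finally show ?case by (simp add: m_assoc nat_pow_mult add.commute)
  qed simp
  moreover have "z [^] (\<Sum>{..<p}) = \<one>"
  proof -
    obtain k where "p = 2 * k + 1" using \<open>odd p\<close> oddE by blast
    moreover have "\<Sum>{..<2 * k + 1} = (2 * k + 1) * k"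
      by (induction k) (auto simp: numeral_eq_Suc algebra_simps)
    ultimately have "z [^] (\<Sum>{..<p}) = (z [^] p) [^] k"
      by (metis assms(3) nat_pow_pow)
    then show ?thesis using zp by simp
  qed
  ultimately show ?thesis by simp
qed

lemma (in group) conjugate_pow:
  assumes "g \<in> carrier G" "x \<in> carrier G"
  shows "(g \<otimes> x \<otimes> inv g) [^] (n::nat) = g \<otimes> x [^] n \<otimes> inv g"
proof (induction n)
  case (Suc n)
  have "(g \<otimes> x \<otimes> inv g) [^] Suc n = g \<otimes> x [^] n \<otimes> (inv g \<otimes> g) \<otimes> x \<otimes> inv g"
    using Suc assms by (simp only: nat_pow_Suc m_assoc m_closed inv_closed nat_pow_closed)
  then show ?case
    using assms by (simp add: m_assoc)
qed (use assms in simp)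

section \<open>Centralizing generated subgroups, and the center\<close>

lemma (in group) commute_inv:
  assumes "a \<in> carrier G" "b \<in> carrier G" "a \<otimes> b = b \<otimes> a"
  shows "inv a \<otimes> b = b \<otimes> inv a"
proof -
  have "a \<otimes> (b \<otimes> inv a) = b"
    using assms by (simp add: m_assoc [symmetric]) (simp add: m_assoc)
  then have "b \<otimes> inv a = inv a \<otimes> b"
    using assms inv_solve_left[of "b \<otimes> inv a" a b] by simp
  then show ?thesis by simp
qed

lemma (in group) generate_commutes:
  assumes "A \<subseteq> carrier G" "b \<in> carrier G" "\<And>a. a \<in> A \<Longrightarrow> a \<otimes> b = b \<otimes> a"
    and "x \<in> generate G A"
  shows "x \<otimes> b = b \<otimes> x"
  using assms(4)
proof (induction x rule: generate.induct)
  case (inv h)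
  then show ?case
    using assms(1-3) by (intro commute_inv) auto
next
  case (eng h1 h2)
  then have h: "h1 \<in> carrier G" "h2 \<in> carrier G"
    using generate_in_carrier[OF assms(1)] by auto
  have "h1 \<otimes> h2 \<otimes> b = h1 \<otimes> b \<otimes> h2"
    using h assms(2) eng.IH(2) by (simp add: m_assoc)
  then show ?case
    using h assms(2) eng.IH(1) by (simp add: m_assoc)
qed (use assms in auto)

lemma (in group) center_eq_generate:
  "generate G (group_center G) = group_center G"
proof
  show "generate G (group_center G) \<subseteq> group_center G"
  proof
    fix x assume x: "x \<in> generate G (group_center G)"
    have "group_center G \<subseteq> carrier G" by (auto simp: group_center_def)
    then show "x \<in> group_center G"
      using x generate_commutes[of "group_center G" _ x] generate_in_carrier[of "group_center G" x]
      by (auto simp: group_center_def)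
  qed
qed (auto intro: generate.incl)

lemma (in group) center_normal: "group_center G \<lhd> G"
proof -
  have "generate G (group_center G) \<lhd> G"
  proof (rule normal_generateI)
    fix h g assume "h \<in> group_center G" "g \<in> carrier G"
    then have "g \<otimes> h \<otimes> inv g = h"
      by (auto simp: group_center_def m_assoc)
        (metis (no_types) inv_closed m_assoc r_inv r_one)
    then show "g \<otimes> h \<otimes> inv g \<in> group_center G"
      using \<open>h \<in> _\<close> by simp
  qed (auto simp: group_center_def)
  then show ?thesis by (simp add: center_eq_generate)
qed

section \<open>Orders in finite p-groups and central elements\<close>

lemma p_group_subgroup_card:
  assumes "p_group p G" "Factorial_Ring.prime p" "subgroup H G"
  obtains k where "card H = p ^ k"
proof -
  interpret group G using assms(1) by (simp add: p_group_def)
  have "card H dvd order G" using lagrange[OF assms(3)] by (metis dvd_triv_right)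
  then show thesis using assms(1,2) that unfolding p_group_def
    by (metis divides_primepow_nat)
qed

lemma p_group_Mod:
  assumes "p_group p G" "Factorial_Ring.prime p" "N \<lhd> G"
  shows "p_group p (G Mod N)"
proof -
  interpret normal N G by fact
  have "order (G Mod N) * card N = order G"
    using lagrange[OF subgroup_axioms] by (simp add: order_def FactGroup_def)
  then have "order (G Mod N) dvd order G" by (metis dvd_triv_left)
  then have "\<exists>n. order (G Mod N) = p ^ n"
    using assms(1,2) unfolding p_group_def by (metis divides_primepow_nat)
  moreover have "finite (carrier (G Mod N))"
    using assms(1) by (simp add: p_group_def carrier_FactGroup)
  ultimately show ?thesis
    using factorgroup_is_group by (simp add: p_group_def)
qed

text \<open>Let G act by conjugation on N without the identity. That set has p^k - 1 elements with k
  > 0, so some orbit has length prime to p; orbit lengths divide the order of G and are powers of p,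
  so this orbit is a single point, which is a central element.\<close>

lemma p_group_normal_meets_center:
  fixes G (structure)
  assumes G: "p_group p G" and p: "Factorial_Ring.prime p" and N: "N \<lhd> G" and ne: "N \<noteq> {\<one>}"
  obtains x where "x \<in> N" "x \<noteq> \<one>" "x \<in> group_center G"
proof -
  interpret normal N G by fact
  let ?\<phi> = "\<lambda>g. (\<lambda>h \<in> carrier G. g \<otimes> h \<otimes> inv g)"
  interpret A: group_action G "carrier G" ?\<phi> by (rule action_by_conjugation)
  have fin: "finite (carrier G)" using G by (simp add: p_group_def)
  let ?P = "N - {\<one>}"
  have PG: "?P \<subseteq> carrier G" using subset by blast
  have conj_one: "x = \<one>" if "x \<in> carrier G" "g \<in> carrier G" "g \<otimes> x \<otimes> inv g = \<one>" for x g
  proof -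
    have "g \<otimes> x = g" using that inv_equality[of "g \<otimes> x" "inv g"] by (metis inv_closed inv_comm inv_inv m_closed)
    then show ?thesis using that by (metis r_cancel_one' l_cancel_one)
  qed
  have orbP: "orbit G ?\<phi> x \<subseteq> ?P" if "x \<in> ?P" for x
    using that inv_op_closed2 subset conj_one by (auto simp: orbit_def)
  have "\<exists>x\<in>?P. \<not> p dvd card (orbit G ?\<phi> x)"
  proof (rule ccontr)
    assume "\<not> ?thesis"
    then have *: "\<forall>x\<in>?P. p dvd card (orbit G ?\<phi> x)" by blast
    let ?C = "orbit G ?\<phi> ` ?P"
    have U: "\<Union>?C = ?P"
      using orbP A.orbit_refl PG by blast
    have "?C \<subseteq> orbits G (carrier G) ?\<phi>" using PG unfolding orbits_def by blast
    then have "\<forall>a\<in>?C. \<forall>b\<in>?C. a \<noteq> b \<longrightarrow> a \<inter> b = {}"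
      using A.disjoint_union by blast
    then have "p dvd card (\<Union>?C)"
      using * fin finite_subset[OF PG fin] U by (intro dvd_partition) auto
    then have "p dvd card N - 1" using U one_closed finite_subset[OF subset fin] by simp
    moreover obtain k where k: "card N = p ^ k"
      using p_group_subgroup_card[OF G p subgroup_axioms] .
    moreover have "card N \<noteq> 1"
    proof
      assume "card N = 1"
      then obtain y where "N = {y}" by (rule card_1_singletonE)
      then show False using ne one_closed by auto
    qed
    ultimately have "p dvd card N - 1" "p dvd card N" by (auto simp: dvd_power)
    moreover have "card N > 0" using k p by (simp add: prime_gt_0_nat)
    ultimately have "p dvd 1" by (metis dvd_diffD1 Suc_leI One_nat_def)
    then show False using p by (simp add: not_prime_unit)
  qed
  then obtain x where x: "x \<in> ?P" "\<not> p dvd card (orbit G ?\<phi> x)" by blast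
  have "card (orbit G ?\<phi> x) dvd order G"
  proof (rule dvdI)
    show "order G = card (orbit G ?\<phi> x) * card (stabilizer G ?\<phi> x)"
      using A.orbit_stabilizer_theorem[of x] x PG by auto
  qed
  then obtain j where "card (orbit G ?\<phi> x) = p ^ j"
    using G divides_primepow_nat[OF p] by (auto simp: p_group_def)
  then have "card (orbit G ?\<phi> x) = 1" using x(2) by (cases j) auto
  then have single: "orbit G ?\<phi> x = {x}"
    using A.orbit_refl[of x] x PG by (fastforce elim!: card_1_singletonE)
  have "g \<otimes> x \<otimes> inv g = x" if "g \<in> carrier G" for g
    using single that x PG unfolding orbit_def by auto
  then have "x \<in> group_center G"
    using x PG unfolding group_center_def 
    using inv_solve_right'[of x "_ \<otimes> x" _] by auto
  then show thesis using that x by auto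
qed

subsection \<open>Commuting modulo a normal subgroup\<close>

text \<open>Encodes [A, B] \<le> N without forming a generated commutator subgroup; for normal N it
  means that the images of A and B commute elementwise in G/N. The instance
  \<open>commutes_mod G (pow_generate G p M) M (carrier G)\<close> expresses, for odd p, that M is
  powerfully embedded in G.\<close>

definition commutes_mod :: "('a, 'b) monoid_scheme \<Rightarrow> 'a set \<Rightarrow> 'a set \<Rightarrow> 'a set \<Rightarrow> bool" where
  "commutes_mod G N A B \<longleftrightarrow>
    (\<forall>a\<in>A. \<forall>b\<in>B. a \<otimes>\<^bsub>G\<^esub> b \<otimes>\<^bsub>G\<^esub> inv\<^bsub>G\<^esub> a \<otimes>\<^bsub>G\<^esub> inv\<^bsub>G\<^esub> b \<in> N)"

lemma commutes_modI:
  "(\<And>a b. a \<in> A \<Longrightarrow> b \<in> B \<Longrightarrow> a \<otimes>\<^bsub>G\<^esub> b \<otimes>\<^bsub>G\<^esub> inv\<^bsub>G\<^esub> a \<otimes>\<^bsub>G\<^esub> inv\<^bsub>G\<^esub> b \<in> N) \<Longrightarrow> commutes_mod G N A B"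
  by (simp add: commutes_mod_def)

lemma commutes_modD:
  "commutes_mod G N A B \<Longrightarrow> a \<in> A \<Longrightarrow> b \<in> B \<Longrightarrow> a \<otimes>\<^bsub>G\<^esub> b \<otimes>\<^bsub>G\<^esub> inv\<^bsub>G\<^esub> a \<otimes>\<^bsub>G\<^esub> inv\<^bsub>G\<^esub> b \<in> N"
  by (simp add: commutes_mod_def)

lemma commutes_mod_mono:
  "commutes_mod G N A B \<Longrightarrow> N \<subseteq> N' \<Longrightarrow> A' \<subseteq> A \<Longrightarrow> B' \<subseteq> B \<Longrightarrow> commutes_mod G N' A' B'"
  unfolding commutes_mod_def by blast

lemma (in subgroup) rcos_eq_iff:
  assumes "group G" "x \<in> carrier G" "y \<in> carrier G"
  shows "H #> x = H #> y \<longleftrightarrow> x \<otimes> inv y \<in> H"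
proof -
  interpret group G by fact
  show ?thesis
    using rcos_module[OF assms(1,3,2)] repr_independence[OF _ assms(3) subgroup_axioms]
      rcos_self[OF assms(2) subgroup_axioms] by metis
qed

context normal
begin

lemma group_hom_rcos: "group_hom G (G Mod H) ((#>) H)"
  using r_coset_hom_Mod factorgroup_is_group by (auto intro!: group_hom.intro group_hom_axioms.intro)

lemma rcos_eq_one_iff: "x \<in> carrier G \<Longrightarrow> H #> x = \<one>\<^bsub>G Mod H\<^esub> \<longleftrightarrow> x \<in> H"
  using rcos_eq_iff[OF is_group, of x \<one>] coset_mult_one[OF subset] by simp

lemma rcos_commute_iff:
  assumes "a \<in> carrier G" "b \<in> carrier G"
  shows "(H #> a) \<otimes>\<^bsub>G Mod H\<^esub> (H #> b) = (H #> b) \<otimes>\<^bsub>G Mod H\<^esub> (H #> a)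
    \<longleftrightarrow> a \<otimes> b \<otimes> inv a \<otimes> inv b \<in> H"
  using assms rcos_eq_iff[OF is_group, of "a \<otimes> b" "b \<otimes> a"]
  by (simp add: rcos_sum inv_mult_group m_assoc)

lemma pow_mem_iff:
  "x \<in> carrier G \<Longrightarrow> x [^] (n::nat) \<in> H \<longleftrightarrow> (H #> x) [^]\<^bsub>G Mod H\<^esub> n = \<one>\<^bsub>G Mod H\<^esub>"
  using rcos_eq_one_iff[of "x [^] n"] by (simp only: FactGroup_pow nat_pow_closed)

lemma commutes_mod_sym:
  assumes "A \<subseteq> carrier G" "B \<subseteq> carrier G" "commutes_mod G H A B"
  shows "commutes_mod G H B A"
proof (rule commutes_modI)
  fix b a assume "b \<in> B" "a \<in> A"
  then show "b \<otimes> a \<otimes> inv b \<otimes> inv a \<in> H"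
    using rcos_commute_iff[of a b] rcos_commute_iff[of b a] commutes_modD[OF assms(3)] assms(1,2)
    by (metis subsetD)
qed

text \<open>In G/H the condition becomes genuine commutation, and the elements commuting with a
  fixed one form a subgroup.\<close>

lemma commutes_mod_generate:
  assumes "A \<subseteq> carrier G" "B \<subseteq> carrier G" "commutes_mod G H A B"
  shows "commutes_mod G H (generate G A) B"
proof (rule commutes_modI)
  interpret Q: group_hom G "G Mod H" "(#>) H" by (rule group_hom_rcos)
  fix a b assume a: "a \<in> generate G A" and b: "b \<in> B"
  have "(H #> a) \<otimes>\<^bsub>G Mod H\<^esub> (H #> b) = (H #> b) \<otimes>\<^bsub>G Mod H\<^esub> (H #> a)"
  proof (rule Q.H.generate_commutes[where A = "(#>) H ` A"])
    show "H #> a \<in> generate (G Mod H) ((#>) H ` A)"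
      using a Q.generate_img[OF assms(1)] by auto
  next
    fix c assume "c \<in> (#>) H ` A"
    then obtain a where a: "a \<in> A" "c = H #> a" by blast
    then show "c \<otimes>\<^bsub>G Mod H\<^esub> (H #> b) = (H #> b) \<otimes>\<^bsub>G Mod H\<^esub> c"
      using rcos_commute_iff[of a b] commutes_modD[OF assms(3) a(1) b] b assms(1,2) by blast
  qed (use assms b in auto)
  then show "a \<otimes> b \<otimes> inv a \<otimes> inv b \<in> H"
    using rcos_commute_iff[of a b] generate_in_carrier[OF assms(1) a] b assms(2) by auto
qed

end

subsection \<open>Subgroups generated by p-th powers\<close>

text \<open>The subgroup A^p, taken for subsets A of one ambient group so that it can be iterated
  along P, P^p, (P^p)^p while normality in G stays available.\<close>

definition pow_generate :: "('a, 'b) monoid_scheme \<Rightarrow> nat \<Rightarrow> 'a set \<Rightarrow> 'a set" where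
  "pow_generate G p A = generate G ((\<lambda>x. x [^]\<^bsub>G\<^esub> p) ` A)"

lemma pow_subgroup_eq: "pow_subgroup G p = pow_generate G p (carrier G)"
  by (simp add: pow_subgroup_def pow_generate_def image_def setcompr_eq_image)

lemma pow_in_pow_generate: "x \<in> A \<Longrightarrow> x [^]\<^bsub>G\<^esub> p \<in> pow_generate G p A"
  by (auto simp: pow_generate_def intro: generate.incl)

lemma (in group) subgroup_nat_pow_closed:
  "subgroup H G \<Longrightarrow> x \<in> H \<Longrightarrow> x [^] (n::nat) \<in> H"
  by (induction n) (auto simp: subgroup.one_closed subgroup.m_closed)

lemma (in group) pow_generate_subset:
  assumes "subgroup H G" shows "pow_generate G p H \<subseteq> H"
  unfolding pow_generate_def
  using assms subgroup_nat_pow_closed by (intro generate_subgroup_incl) auto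

lemma (in group) pow_generate_normal:
  assumes "N \<lhd> G" shows "pow_generate G p N \<lhd> G"
  unfolding pow_generate_def
proof (rule normal_generateI)
  interpret normal N G by fact
  fix h g assume h: "h \<in> (\<lambda>x. x [^] p) ` N" and g: "g \<in> carrier G"
  then obtain x where x: "x \<in> N" "h = x [^] p" by blast
  then have "g \<otimes> h \<otimes> inv g = (g \<otimes> x \<otimes> inv g) [^] p"
    using conjugate_pow[OF g] subset by auto
  then show "g \<otimes> h \<otimes> inv g \<in> (\<lambda>x. x [^] p) ` N"
    using inv_op_closed2[OF g x(1)] by auto
qed (use assms normal_imp_subgroup subgroup.subset in fastforce)

section \<open>Central chief factors and powerful embedding\<close>

text \<open>Take M maximal among the normal subgroups with K \<le> M < N. Since N/M meets the center
  of G/M, a central element of order p in it spans, together with M, a normal subgroup of G; by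
  maximality this is N. So N/M is central and of exponent p.\<close>

lemma exists_chief_subgroup:
  fixes G (structure)
  assumes G: "p_group p G" and p: "Factorial_Ring.prime p"
    and K: "K \<lhd> G" and N: "N \<lhd> G" and KN: "K \<subset> N"
  obtains M where "M \<lhd> G" "K \<subseteq> M" "M \<subset> N" "commutes_mod G M N (carrier G)"
    "\<And>x. x \<in> N \<Longrightarrow> x [^] p \<in> M"
proof -
  interpret group G using G by (simp add: p_group_def)
  have fin: "finite (carrier G)" using G by (simp add: p_group_def)
  let ?S = "{M. M \<lhd> G \<and> K \<subseteq> M \<and> M \<subset> N}"
  have "finite ?S"
  proof (rule finite_subset)
    show "?S \<subseteq> Pow (carrier G)" using normal_imp_subgroup subgroup.subset by blast
  qed (use fin in simp)
  moreover have "K \<in> ?S" using K KN by blast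
  ultimately obtain M where M: "M \<in> ?S" and max: "\<And>M'. M' \<in> ?S \<Longrightarrow> M \<subseteq> M' \<Longrightarrow> M' = M"
    using finite_has_maximal2[of ?S K] by (metis (no_types, lifting))
  then have MG: "M \<lhd> G" and MN: "M \<subset> N" and KM: "K \<subseteq> M" by auto
  interpret M: normal M G by fact
  interpret N: normal N G by fact
  interpret Q: group_hom G "G Mod M" "(#>) M" by (rule M.group_hom_rcos)
  let ?Q = "G Mod M"
  let ?N = "(#>) M ` N"
  have QN: "?N \<lhd> ?Q"
  proof (rule N.surj_hom_normal_subgroup)
    show "group_hom G ?Q ((#>) M)" by (rule M.group_hom_rcos)
    show "(#>) M ` carrier G = carrier ?Q" by (simp add: carrier_FactGroup)
  qed
  obtain y where y: "y \<in> N" "y \<notin> M" using MN by blast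
  then have "?N \<noteq> {\<one>\<^bsub>?Q\<^esub>}"
    using M.rcos_eq_one_iff[of y] N.subset by (metis image_eqI singletonD subsetD)
  from p_group_normal_meets_center[OF p_group_Mod[OF G p MG] p QN this]
  obtain c where "c \<in> ?N" "c \<noteq> \<one>\<^bsub>?Q\<^esub>" "c \<in> group_center ?Q" .
  then obtain x where x: "x \<in> N" "x \<notin> M" and xc: "M #> x \<in> group_center ?Q"
    using M.rcos_eq_one_iff N.subset by auto
  obtain k where k: "order G = p ^ k" using G by (auto simp: p_group_def)
  have xG: "x \<in> carrier G" using x N.subset by blast
  have "x [^] (p ^ k) = \<one>" using pow_order_eq_1[OF xG] k by simp
  then have ex: "x [^] (p ^ k) \<in> M" using M.one_closed by simp
  \<comment> \<open>The least j is positive because x lies outside M; one step earlier the power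
    \<open>z\<close> is still outside M while its p-th power is inside, and it remains central
    modulo M.\<close>
  define j where "j = (LEAST j. x [^] (p ^ j) \<in> M)"
  have jM: "x [^] (p ^ j) \<in> M" unfolding j_def using ex by (rule LeastI)
  have "j \<noteq> 0" using jM x xG by (auto intro: Nat.gr0I)
  then obtain i where i: "j = Suc i" by (cases j) auto
  define z where "z = x [^] (p ^ i)"
  have zM: "z \<notin> M" unfolding z_def using not_less_Least[of i "\<lambda>j. x [^] (p ^ j) \<in> M"] i
    by (simp add: j_def)
  have zN: "z \<in> N" unfolding z_def using subgroup_nat_pow_closed[OF N.subgroup_axioms x(1)] .
  then have zG: "z \<in> carrier G" using N.subset by blast
  have zp: "z [^] p \<in> M" using jM xG by (simp add: z_def nat_pow_pow i mult.commute)
  have zc: "commutes_mod G M {z} (carrier G)"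
  proof -
    have "commutes_mod G M {x} (carrier G)"
    proof (rule commutes_modI)
      fix a b assume a: "a \<in> {x}" and b: "b \<in> carrier G"
      have "(M #> x) \<otimes>\<^bsub>?Q\<^esub> (M #> b) = (M #> b) \<otimes>\<^bsub>?Q\<^esub> (M #> x)"
        using xc Q.hom_closed[OF b] unfolding group_center_def by blast
      then show "a \<otimes> b \<otimes> inv a \<otimes> inv b \<in> M"
        using a b M.rcos_commute_iff[OF xG b] by blast
    qed
    then have "commutes_mod G M (generate G {x}) (carrier G)"
      using xG by (intro M.commutes_mod_generate) auto
    moreover have "z \<in> generate G {x}"
      unfolding z_def using xG by (intro subgroup_nat_pow_closed generate_is_subgroup generate.incl) auto
    ultimately show ?thesis by (auto simp: commutes_mod_def)
  qed
  let ?M = "generate G (insert z M)"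
  have sub: "insert z M \<subseteq> carrier G" using zG M.subset by auto
  have "commutes_mod G M (insert z M) (carrier G)"
  proof (rule commutes_modI)
    fix a b assume a: "a \<in> insert z M" and b: "b \<in> carrier G"
    show "a \<otimes> b \<otimes> inv a \<otimes> inv b \<in> M"
    proof (cases "a = z")
      case True then show ?thesis using commutes_modD[OF zc] b by blast
    next
      case False
      then have "a \<in> M" using a by blast
      then have "a \<otimes> (b \<otimes> inv a \<otimes> inv b) \<in> M"
        using M.inv_op_closed2[OF b M.m_inv_closed] by simp
      then show ?thesis using \<open>a \<in> M\<close> b M.subset by (simp add: m_assoc)
    qed
  qed
  then have cM: "commutes_mod G M ?M (carrier G)"
    by (rule M.commutes_mod_generate[OF sub order_refl])
  \<comment> \<open>A conjugate of h by g is h times the commutator of \<open>inv h\<close> and g,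
    and that commutator already lies in M.\<close>
  have "?M \<lhd> G"
  proof (rule normal_invI)
    show "subgroup ?M G" using generate_is_subgroup[OF sub] .
    fix g h assume g: "g \<in> carrier G" and h: "h \<in> ?M"
    have hG: "h \<in> carrier G" using generate_in_carrier[OF sub h] .
    have "inv h \<in> ?M" using generate_m_inv_closed[OF sub h] .
    then have "inv h \<otimes> g \<otimes> inv (inv h) \<otimes> inv g \<in> ?M"
      using commutes_modD[OF cM] g generate.incl[of _ "insert z M" G] by blast
    then have "h \<otimes> (inv h \<otimes> g \<otimes> h \<otimes> inv g) \<in> ?M"
      using h hG by (simp add: generate.eng)
    moreover have "h \<otimes> (inv h \<otimes> g \<otimes> h \<otimes> inv g) = (h \<otimes> inv h) \<otimes> g \<otimes> h \<otimes> inv g"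
      using hG g by (simp only: m_assoc m_closed inv_closed)
    ultimately show "g \<otimes> h \<otimes> inv g \<in> ?M" using hG g by simp
  qed
  moreover have "?M \<subseteq> N"
    using zN MN by (intro generate_subgroup_incl) (auto simp: N.subgroup_axioms)
  moreover have MM: "M \<subseteq> ?M" and "z \<in> ?M" by (auto intro: generate.incl)
  ultimately have "?M = N" using max[of ?M] KM zM by blast
  \<comment> \<open>Since \<open>?M\<close> is central modulo M, p-th powers are multiplicative
    there, and only the generators z and M have to be checked.\<close>
  have pow: "x [^] p \<in> M" if "x \<in> ?M" for x
    using that
  proof (induction x rule: generate.induct)
    case one
    show ?case using M.one_closed by simp
  next
    case (incl h)
    then show ?case using zp subgroup_nat_pow_closed[OF M.subgroup_axioms] by blast
  next
    case (inv h)
    then have "h [^] p \<in> M" using zp subgroup_nat_pow_closed[OF M.subgroup_axioms] by blast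
    moreover have "h \<in> carrier G" using inv sub by blast
    ultimately show ?case using M.m_inv_closed by (simp only: nat_pow_inv)
  next
    case (eng a b)
    have ab: "a \<in> carrier G" "b \<in> carrier G" using eng generate_in_carrier[OF sub] by auto
    then have "(M #> a) \<otimes>\<^bsub>?Q\<^esub> (M #> b) = (M #> b) \<otimes>\<^bsub>?Q\<^esub> (M #> a)"
      using M.rcos_commute_iff commutes_modD[OF cM] eng by blast
    then have "((M #> a) \<otimes>\<^bsub>?Q\<^esub> (M #> b)) [^]\<^bsub>?Q\<^esub> p
        = (M #> a) [^]\<^bsub>?Q\<^esub> p \<otimes>\<^bsub>?Q\<^esub> (M #> b) [^]\<^bsub>?Q\<^esub> p"
      using Q.hom_closed[OF ab(1)] Q.hom_closed[OF ab(2)] by (rule Q.H.pow_mult_distrib)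
    also have "\<dots> = \<one>\<^bsub>?Q\<^esub> \<otimes>\<^bsub>?Q\<^esub> \<one>\<^bsub>?Q\<^esub>"
      using eng.IH M.pow_mem_iff[OF ab(1)] M.pow_mem_iff[OF ab(2)] by simp
    also have "\<dots> = \<one>\<^bsub>?Q\<^esub>" by (rule Q.H.l_one[OF Q.H.one_closed])
    finally show ?case
      using M.pow_mem_iff[OF m_closed[OF ab]] Q.hom_mult[OF ab] by simp
  qed
  then show thesis
    using that[OF MG KM MN] cM pow \<open>?M = N\<close> by simp
qed

text \<open>
  With \<open>A = M\<^sub>0\<close> and \<open>M = M\<^sub>0\<^sup>p\<close> this says that \<open>M\<^sub>0\<^sup>p\<close> is powerfully embedded if \<open>M\<^sub>0\<close> is; with
  \<open>A = G\<close> and \<open>M = [G, G]\<close> it yields that the derived subgroup of a quasi-powerful group is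
  powerfully embedded. Let \<open>W \<ge> M\<^sup>p\<close> be minimal among the normal
  subgroups containing \<open>[M, G]\<close>. If \<open>W \<noteq> M\<^sup>p\<close>, then some normal \<open>J\<close> with \<open>M\<^sup>p \<le> J < W\<close> makes
  \<open>W/J\<close> central of exponent \<open>p\<close>; hence \<open>p\<close>-th powers of elements of \<open>A\<close> are central
  modulo \<open>J\<close>, so \<open>[M, G] \<le> J\<close>, against the choice of \<open>W\<close>.
\<close>

lemma pow_generate_commutes:
  fixes G (structure)
  assumes G: "p_group p G" and p: "Factorial_Ring.prime p" "odd p"
    and M: "M \<lhd> G" and A: "A \<subseteq> carrier G" "commutes_mod G M A (carrier G)"
    and gen: "M \<subseteq> generate G ((\<lambda>x. x [^] p) ` A \<union> group_center G)"
  shows "commutes_mod G (pow_generate G p M) M (carrier G)"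
proof -
  interpret group G using G by (simp add: p_group_def)
  interpret M: normal M G by fact
  have fin: "finite (carrier G)" using G by (simp add: p_group_def)
  let ?K = "pow_generate G p M"
  let ?S = "{W. W \<lhd> G \<and> ?K \<subseteq> W \<and> commutes_mod G W M (carrier G)}"
  have "finite ?S"
  proof (rule finite_subset)
    show "?S \<subseteq> Pow (carrier G)" using normal_imp_subgroup subgroup.subset by blast
  qed (use fin in simp)
  \<comment> \<open>Normality gives [M, G] \<le> M, so there is a candidate for W to start
    from.\<close>
  moreover have "M \<in> ?S"
  proof -
    have "commutes_mod G M (carrier G) M"
    proof (rule commutes_modI)
      fix g m assume "g \<in> carrier G" "m \<in> M"
      then show "g \<otimes> m \<otimes> inv g \<otimes> inv m \<in> M" using M.inv_op_closed2 by auto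
    qed
    then show ?thesis
      using M M.commutes_mod_sym M.subset pow_generate_subset[OF M.subgroup_axioms] by auto
  qed
  ultimately obtain W where WS: "W \<in> ?S" and min: "\<And>W'. W' \<in> ?S \<Longrightarrow> W' \<subseteq> W \<Longrightarrow> W' = W"
    using finite_has_minimal2[of ?S M] by (metis (no_types, lifting))
  then have W: "W \<lhd> G" and KW: "?K \<subseteq> W" and MW: "commutes_mod G W M (carrier G)" by auto
  interpret W: normal W G by fact
  have "W = ?K"
  proof (rule ccontr)
    assume "W \<noteq> ?K"
    then have "?K \<subset> W" using KW by blast
    from exists_chief_subgroup[OF G p(1) pow_generate_normal[OF M] W this]
    obtain J where J: "J \<lhd> G" "?K \<subseteq> J" "J \<subset> W" and WJ: "commutes_mod G J W (carrier G)"
      and pJ: "\<And>x. x \<in> W \<Longrightarrow> x [^] p \<in> J" by blast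
    interpret J: normal J G by fact
    interpret Q: group_hom G "G Mod J" "(#>) J" by (rule J.group_hom_rcos)
    have "commutes_mod G J (carrier G) ((\<lambda>x. x [^] p) ` A)"
    proof (rule commutes_modI)
      fix g y assume g: "g \<in> carrier G" and "y \<in> (\<lambda>x. x [^] p) ` A"
      then obtain x where x: "x \<in> A" "y = x [^] p" by blast
      have xG: "x \<in> carrier G" using x A by blast
      define c where "c = g \<otimes> x \<otimes> inv g \<otimes> inv x"
      have cM: "c \<in> M"
        using commutes_modD[OF M.commutes_mod_sym[OF A(1) _ A(2)]] g x by (simp add: c_def)
      then have cG: "c \<in> carrier G" using M.subset by blast
      have cx: "c \<otimes> x = g \<otimes> x \<otimes> inv g" using g xG by (simp add: c_def m_assoc)
      \<comment> \<open>This commutator of \<open>inv x\<close> and \<open>inv c\<close> lies in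
        [G, M] \<le> W, so modulo J it is central with trivial p-th power. The class-two formula
        then gives (g x g^-1)^p = (c x)^p = c^p x^p modulo J, and c^p lies in M^p \<le> J:
        conjugation by g fixes x^p modulo J.\<close>
      define z where "z = inv x \<otimes> inv c \<otimes> x \<otimes> c"
      have zW: "z \<in> W"
        using commutes_modD[OF W.commutes_mod_sym[OF M.subset _ MW], of "inv x" "inv c"] xG cM cG
        by (simp add: z_def)
      have zG: "z \<in> carrier G" using zW W.subset by blast
      have xc: "x \<otimes> c = c \<otimes> x \<otimes> z"
      proof -
        have "c \<otimes> x \<otimes> z = c \<otimes> (x \<otimes> inv x) \<otimes> inv c \<otimes> x \<otimes> c"
          unfolding z_def using xG cG by (simp only: m_assoc m_closed inv_closed)
        then show ?thesis using xG cG by simp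
      qed
      have zcomm: "(J #> z) \<otimes>\<^bsub>G Mod J\<^esub> (J #> h) = (J #> h) \<otimes>\<^bsub>G Mod J\<^esub> (J #> z)"
        if "h \<in> carrier G" for h
        using J.rcos_commute_iff[OF zG that] commutes_modD[OF WJ zW that] by blast
      have "((J #> c) \<otimes>\<^bsub>G Mod J\<^esub> (J #> x)) [^]\<^bsub>G Mod J\<^esub> p
          = (J #> c) [^]\<^bsub>G Mod J\<^esub> p \<otimes>\<^bsub>G Mod J\<^esub> (J #> x) [^]\<^bsub>G Mod J\<^esub> p"
      proof (rule Q.H.pow_mult_class_two)
        show "(J #> x) \<otimes>\<^bsub>G Mod J\<^esub> (J #> c) = (J #> c) \<otimes>\<^bsub>G Mod J\<^esub> (J #> x) \<otimes>\<^bsub>G Mod J\<^esub> (J #> z)"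
          using xc xG cG zG by (simp only: Q.hom_mult [symmetric] m_closed)
        show "(J #> z) [^]\<^bsub>G Mod J\<^esub> p = \<one>\<^bsub>G Mod J\<^esub>"
          using J.pow_mem_iff[OF zG] pJ[OF zW] by blast
      qed (use zcomm xG cG zG p in auto)
      moreover have "(J #> c) [^]\<^bsub>G Mod J\<^esub> p = \<one>\<^bsub>G Mod J\<^esub>"
        using J.pow_mem_iff[OF cG] pow_in_pow_generate[OF cM] J(2) by blast
      moreover have "(J #> x) [^]\<^bsub>G Mod J\<^esub> p \<in> carrier (G Mod J)"
        using xG by (intro Q.H.nat_pow_closed) auto
      ultimately have "(J #> (c \<otimes> x)) [^]\<^bsub>G Mod J\<^esub> p = (J #> x) [^]\<^bsub>G Mod J\<^esub> p"
        using xG cG by (simp only: Q.hom_mult Q.H.l_one)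
      then have "J #> ((c \<otimes> x) [^] p) = J #> (x [^] p)"
        using xG cG by (simp only: J.FactGroup_pow m_closed)
      then have "J #> (g \<otimes> y \<otimes> inv g) = J #> y"
        using conjugate_pow[OF g xG] x(2) cx by simp
      then show "g \<otimes> y \<otimes> inv g \<otimes> inv y \<in> J"
        using J.rcos_eq_iff[OF is_group, of "g \<otimes> y \<otimes> inv g" y] g xG x(2) by simp
    qed
    moreover have "(\<lambda>x. x [^] p) ` A \<subseteq> carrier G" using A by auto
    ultimately have "commutes_mod G J ((\<lambda>x. x [^] p) ` A) (carrier G)"
      by (metis J.commutes_mod_sym order_refl)
    moreover have "commutes_mod G J (group_center G) (carrier G)"
    proof (rule commutes_modI)
      fix z g assume z: "z \<in> group_center G" and g: "g \<in> carrier G"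
      then have "z \<otimes> g \<otimes> inv z \<otimes> inv g = g \<otimes> (z \<otimes> inv z) \<otimes> inv g"
        by (auto simp: group_center_def m_assoc)
      then show "z \<otimes> g \<otimes> inv z \<otimes> inv g \<in> J"
        using z g J.one_closed by (simp add: group_center_def)
    qed
    ultimately have "commutes_mod G J ((\<lambda>x. x [^] p) ` A \<union> group_center G) (carrier G)"
      by (auto simp: commutes_mod_def)
    then have "commutes_mod G J (generate G ((\<lambda>x. x [^] p) ` A \<union> group_center G)) (carrier G)"
      using A by (intro J.commutes_mod_generate) (auto simp: group_center_def)
    then have "commutes_mod G J M (carrier G)"
      using gen by (rule commutes_mod_mono[OF _ order_refl _ order_refl])
    then have "J = W" using min[of J] J by blast
    then show False using J(3) by blast
  qed
  then show ?thesis using MW by simp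
qed

subsection \<open>Generators of subgroups of powerful groups\<close>

text \<open>Every element added from outside the current subgroup multiplies its order by at least
  p, because all subgroup orders are powers of p. The inequality thus bounds the number of new
  generators by the logarithm of the index.\<close>

lemma extend_generators:
  fixes K (structure)
  assumes K: "p_group p K" and p: "Factorial_Ring.prime p"
    and "subgroup U K" "subgroup V K" "U \<subseteq> V"
  shows "\<exists>S. finite S \<and> S \<subseteq> V \<and> generate K (U \<union> S) = V \<and> p ^ card S * card U \<le> card V"
  using assms(3-5)
proof (induction "card V - card U" arbitrary: U rule: less_induct)
  case less
  interpret group K using K by (simp add: p_group_def)
  interpret V: subgroup V K by fact
  interpret U: subgroup U K by fact
  have fin: "finite V" using K V.subset finite_subset by (auto simp: p_group_def)
  show ?case
  proof (cases "U = V")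
    case True
    then show ?thesis
      using generate_subgroup_incl[OF order_refl less.prems(1)] by (intro exI[of _ "{}"]) (auto intro: generate.incl)
  next
    case False
    then obtain x where x: "x \<in> V" "x \<notin> U" using less.prems(3) by blast
    let ?U = "generate K (insert x U)"
    have sub: "insert x U \<subseteq> carrier K" using x V.subset U.subset by auto
    have U'V: "?U \<subseteq> V"
      using x less.prems by (intro generate_subgroup_incl) auto
    have UU': "U \<subset> ?U" using x by (auto intro: generate.incl)
    have U': "subgroup ?U K" by (rule generate_is_subgroup[OF sub])
    have lt: "card U < card ?U" using UU' finite_subset[OF U'V fin] by (rule psubset_card_mono[rotated])
    have le: "card ?U \<le> card V" using U'V fin by (rule card_mono[rotated])
    obtain a where a: "card U = p ^ a" using p_group_subgroup_card[OF K p less.prems(1)] .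
    obtain b where b: "card ?U = p ^ b" using p_group_subgroup_card[OF K p U'] .
    have p1: "1 < p" using p by (rule prime_gt_1_nat)
    then have "a < b" using lt a b by simp
    then have "p ^ Suc a \<le> p ^ b" using p1 by (intro power_increasing) auto
    then have pU: "p * card U \<le> card ?U" using a b by simp
    have "card V - card ?U < card V - card U" using lt le by linarith
    from less.hyps[OF this U' less.prems(2) U'V]
    obtain S where S: "finite S" "S \<subseteq> V" "generate K (?U \<union> S) = V" "p ^ card S * card ?U \<le> card V" by blast
    have "generate K (U \<union> insert x S) = V"
    proof
      show "generate K (U \<union> insert x S) \<subseteq> V"
        using x S less.prems by (intro generate_subgroup_incl) auto
      have sub2: "U \<union> insert x S \<subseteq> carrier K" using sub S V.subset by auto
      have "?U \<subseteq> generate K (U \<union> insert x S)" by (rule mono_generate) auto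
      moreover have "S \<subseteq> generate K (U \<union> insert x S)" by (auto intro: generate.incl)
      ultimately have "generate K (?U \<union> S) \<subseteq> generate K (U \<union> insert x S)"
        by (intro generate_subgroup_incl generate_is_subgroup sub2) auto
      then show "V \<subseteq> generate K (U \<union> insert x S)" using S(3) by simp
    qed
    moreover have "p ^ card (insert x S) * card U \<le> card V"
    proof -
      have "p ^ card (insert x S) \<le> p ^ Suc (card S)"
        using p1 S(1) by (intro power_increasing) (auto simp: card_insert_if)
      then have "p ^ card (insert x S) * card U \<le> p ^ Suc (card S) * card U"
        by (rule mult_le_mono1)
      also have "\<dots> = p ^ card S * (p * card U)" by simp
      also have "\<dots> \<le> p ^ card S * card ?U" using pU by (rule mult_le_mono2)
      finally show ?thesis using S(4) by linarith
    qed
    ultimately show ?thesis using S x by (intro exI[of _ "insert x S"]) auto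
  qed
qed

text \<open>If b and a lie in the same coset of H, then b = (b a^-1) a with b a^-1 in C \<inter> H.
  This lifts generation in G/H back to G, at the price of adjoining C \<inter> H.\<close>

lemma (in normal) subset_generate_mod:
  assumes T: "T \<subseteq> C" and C: "subgroup C G" and B: "B \<subseteq> C" "(#>) H ` B \<subseteq> (#>) H ` generate G T"
  shows "B \<subseteq> generate G (T \<union> (C \<inter> H))"
proof
  interpret C: subgroup C G by fact
  fix b assume b: "b \<in> B"
  then obtain a where a: "a \<in> generate G T" "H #> b = H #> a" using B by blast
  have aC: "a \<in> C" using a(1) generate_subgroup_incl[OF T C] by blast
  have bC: "b \<in> C" using b B by blast
  have "b \<otimes> inv a \<in> H"
    using rcos_eq_iff[OF is_group C.mem_carrier[OF bC] C.mem_carrier[OF aC]] a(2) by blast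
  then have "b \<otimes> inv a \<in> generate G (T \<union> (C \<inter> H))"
    using aC bC by (intro generate.incl) auto
  moreover have "a \<in> generate G (T \<union> (C \<inter> H))"
    using a(1) mono_generate[of T "T \<union> (C \<inter> H)"] by blast
  ultimately have "b \<otimes> inv a \<otimes> a \<in> generate G (T \<union> (C \<inter> H))"
    by (rule generate.eng)
  then show "b \<in> generate G (T \<union> (C \<inter> H))"
    using C.mem_carrier[OF bC] C.mem_carrier[OF aC] by (simp add: m_assoc)
qed

text \<open>The choice made in one layer: \<open>extend_generators\<close> is applied to the images
  in G/N, each new coset is represented by one element of B, and the rest of B is absorbed by B
  \<inter> N.\<close>

lemma extend_generators_mod:
  fixes G (structure)
  assumes G: "p_group p G" and p: "Factorial_Ring.prime p" and N: "N \<lhd> G"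
    and A: "subgroup A G" and B: "subgroup B G" and AB: "A \<subseteq> B"
  obtains T where "finite T" "T \<subseteq> B" "p ^ card T * card ((#>) N ` A) \<le> card ((#>) N ` B)"
    "(#>) N ` generate G (A \<union> T) = (#>) N ` B" "B \<subseteq> generate G (A \<union> T \<union> (B \<inter> N))"
proof -
  interpret N: normal N G by fact
  interpret Q: group_hom G "G Mod N" "(#>) N" by (rule N.group_hom_rcos)
  interpret B: subgroup B G by fact
  have "subgroup ((#>) N ` A) (G Mod N)" "subgroup ((#>) N ` B) (G Mod N)"
    using A B Q.subgroup_img_is_subgroup by auto
  from extend_generators[OF p_group_Mod[OF G p N] p this image_mono[OF AB]]
  obtain S where S: "finite S" "S \<subseteq> (#>) N ` B" "generate (G Mod N) ((#>) N ` A \<union> S) = (#>) N ` B"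
    "p ^ card S * card ((#>) N ` A) \<le> card ((#>) N ` B)" by blast
  from S(2) obtain T where T: "T \<subseteq> B" "inj_on ((#>) N) T" "S = (#>) N ` T"
    by (metis subset_image_inj)
  have sub: "A \<union> T \<subseteq> B" using AB T by auto
  have im: "(#>) N ` generate G (A \<union> T) = (#>) N ` B"
    using Q.generate_img[OF order_trans[OF sub B.subset]] S(3) T(3) by (simp only: image_Un)
  have "B \<subseteq> generate G (A \<union> T \<union> (B \<inter> N))"
    using im by (intro N.subset_generate_mod sub B) auto
  moreover have "finite T" "card T = card S" using T S(1) by (auto simp: finite_image_iff card_image)
  ultimately show thesis using that T im S(4) by simp
qed

section \<open>Index inequalities for homomorphic images\<close>

lemma (in group_hom) card_image_kernel:
  "card (h ` carrier G) * card (kernel G H h) = order G"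
proof -
  let ?K = "kernel G H h"
  interpret K: normal ?K G by (rule normal_kernel)
  obtain g where g: "g \<in> hom (G Mod ?K) H" "\<And>x. x \<in> carrier G \<Longrightarrow> g (?K #> x) = h x"
    using FactGroup_universal_kernel[OF normal_kernel] by blast
  have "inj_on g (rcosets ?K)"
  proof (rule inj_onI)
    fix c d assume "c \<in> rcosets ?K" "d \<in> rcosets ?K" and eq: "g c = g d"
    then obtain x y where xy: "x \<in> carrier G" "y \<in> carrier G" "c = ?K #> x" "d = ?K #> y"
      by (auto simp: RCOSETS_def)
    then have "h x = h y" using eq g(2) by metis
    moreover have "h (x \<otimes> inv y) = h x \<otimes>\<^bsub>H\<^esub> inv\<^bsub>H\<^esub> h y"
      by (metis xy(1,2) hom_mult hom_inv G.inv_closed)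
    ultimately have "h (x \<otimes> inv y) = \<one>\<^bsub>H\<^esub>"
      by (metis H.r_inv hom_closed xy(2))
    then have "x \<otimes> inv y \<in> ?K"
      unfolding kernel_def using G.m_closed[OF xy(1) G.inv_closed[OF xy(2)]] by blast
    then show "c = d" using xy(3,4) K.rcos_eq_iff[OF G.is_group xy(1,2)] by metis
  qed
  moreover have "g ` (rcosets ?K) = h ` carrier G"
    using g(2) by (force simp: RCOSETS_def)
  ultimately have "card (h ` carrier G) = card (rcosets ?K)" by (metis card_image)
  then show ?thesis using G.lagrange[OF subgroup_kernel] by simp
qed

text \<open>An index cannot grow under a homomorphism: [h(G) : h(V)] \<le> [G : V], cleared of
  denominators. After the isomorphism theorem it only says that the kernel of h on V is contained in
  the kernel on G.\<close>

lemma (in group_hom) card_subgroup_image_le: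
  assumes fin: "finite (carrier G)" and V: "subgroup V G"
  shows "card V * card (h ` carrier G) \<le> card (h ` V) * card (carrier G)"
proof -
  interpret V: group_hom "G\<lparr>carrier := V\<rparr>" H h by (rule induced_group_hom'[OF V])
  let ?K = "kernel G H h" and ?L = "kernel (G\<lparr>carrier := V\<rparr>) H h"
  have "?L \<subseteq> ?K" using subgroup.subset[OF V] by (auto simp: kernel_def)
  moreover have "finite ?K" using fin by (simp add: kernel_def)
  ultimately have "card ?L \<le> card ?K" by (rule card_mono[rotated])
  moreover have "card V = card (h ` V) * card ?L"
    using V.card_image_kernel by (simp add: order_def)
  moreover have "card (carrier G) = card (h ` carrier G) * card ?K"
    using card_image_kernel by (simp add: order_def)
  ultimately show ?thesis
    using mult_le_mono2[of "card ?L" "card ?K" "card (h ` V) * card (h ` carrier G)"]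
    by (simp add: mult_ac)
qed

text \<open>The preceding inequality for the map that h induces on G/H. It will be applied to the
  p-th power map from one layer to the next.\<close>

lemma (in normal) card_cosets_image_le:
  assumes fin: "finite (carrier G)" and h: "h \<in> hom G K" and K: "group K"
    and ker: "\<And>x. x \<in> H \<Longrightarrow> h x = \<one>\<^bsub>K\<^esub>" and A: "subgroup A G"
  shows "card ((#>) H ` A) * card (h ` carrier G) \<le> card (h ` A) * card ((#>) H ` carrier G)"
proof -
  interpret h: group_hom G K h using h K by (intro group_hom.intro group_hom_axioms.intro) auto
  interpret Q: group_hom G "G Mod H" "(#>) H" by (rule group_hom_rcos)
  have "H \<subseteq> kernel G K h" using ker subset by (auto simp: kernel_def)
  then obtain g where g: "g \<in> hom (G Mod H) K" "\<And>x. x \<in> carrier G \<Longrightarrow> g (H #> x) = h x"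
    using h.FactGroup_universal_kernel[OF normal_axioms] by blast
  interpret g: group_hom "G Mod H" K g
    using g(1) K Q.H.is_group by (intro group_hom.intro group_hom_axioms.intro) auto
  have "g ` ((#>) H ` A) = h ` A"
    unfolding image_image using g(2) subgroup.subset[OF A] by (intro image_cong) auto
  moreover have "g ` carrier (G Mod H) = h ` carrier G"
    unfolding image_image carrier_FactGroup using g(2) by (intro image_cong) auto
  moreover have "finite (carrier (G Mod H))" using fin by (simp add: carrier_FactGroup)
  ultimately show ?thesis
    using g.card_subgroup_image_le[OF _ Q.subgroup_img_is_subgroup[OF A]]
    by (simp add: carrier_FactGroup)
qed

section \<open>The p-th power map between layers and the telescoping estimate\<close>

text \<open>Commutators of elements of P lie in N, and N is central of exponent dividing p modulo M,
  so \<open>pow_mult_class_two\<close> applies in G/M. The intended case is N = P^p and M =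
  N^p.\<close>

lemma pow_hom_mod:
  fixes G (structure) and p :: nat
  assumes "group G" and P: "P \<lhd> G" and N: "N \<lhd> G" and M: "M \<lhd> G" and "odd p"
    and PN: "commutes_mod G N P (carrier G)" and NM: "commutes_mod G M N (carrier G)"
    and NpM: "\<And>x. x \<in> N \<Longrightarrow> x [^] p \<in> M"
  shows "(\<lambda>x. M #> x [^] p) \<in> hom (G\<lparr>carrier := P\<rparr>) (G Mod M)"
proof -
  interpret group G by fact
  interpret P: normal P G by fact
  interpret N: normal N G by fact
  interpret M: normal M G by fact
  interpret Q: group_hom G "G Mod M" "(#>) M" by (rule M.group_hom_rcos)
  have "M #> (x \<otimes> y) [^] p = (M #> x [^] p) \<otimes>\<^bsub>G Mod M\<^esub> (M #> y [^] p)"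
    if "x \<in> P" "y \<in> P" for x y
  proof -
    have x: "x \<in> carrier G" and y: "y \<in> carrier G" using that P.subset by auto
    define z where "z = inv y \<otimes> inv x \<otimes> y \<otimes> x"
    have zN: "z \<in> N"
      using commutes_modD[OF PN, of "inv y" "inv x"] that x y by (simp add: z_def)
    then have z: "z \<in> carrier G" using N.subset by blast
    have yx: "y \<otimes> x = x \<otimes> y \<otimes> z"
    proof -
      have "x \<otimes> y \<otimes> z = x \<otimes> (y \<otimes> inv y) \<otimes> inv x \<otimes> y \<otimes> x"
        unfolding z_def using x y by (simp only: m_assoc m_closed inv_closed)
      then show ?thesis using x y by simp
    qed
    have zcomm: "(M #> z) \<otimes>\<^bsub>G Mod M\<^esub> (M #> h) = (M #> h) \<otimes>\<^bsub>G Mod M\<^esub> (M #> z)"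
      if "h \<in> carrier G" for h
      using M.rcos_commute_iff[OF z that] commutes_modD[OF NM zN that] by blast
    have "((M #> x) \<otimes>\<^bsub>G Mod M\<^esub> (M #> y)) [^]\<^bsub>G Mod M\<^esub> p
        = (M #> x) [^]\<^bsub>G Mod M\<^esub> p \<otimes>\<^bsub>G Mod M\<^esub> (M #> y) [^]\<^bsub>G Mod M\<^esub> p"
    proof (rule Q.H.pow_mult_class_two)
      show "(M #> y) \<otimes>\<^bsub>G Mod M\<^esub> (M #> x) = (M #> x) \<otimes>\<^bsub>G Mod M\<^esub> (M #> y) \<otimes>\<^bsub>G Mod M\<^esub> (M #> z)"
        using yx x y z by (simp only: Q.hom_mult [symmetric] m_closed)
      show "(M #> z) [^]\<^bsub>G Mod M\<^esub> p = \<one>\<^bsub>G Mod M\<^esub>"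
        using M.pow_mem_iff[OF z] NpM[OF zN] by blast
    qed (use zcomm x y z \<open>odd p\<close> in auto)
    then show ?thesis
      using x y by (simp only: Q.hom_mult [symmetric] M.FactGroup_pow m_closed)
  qed
  then show ?thesis
    using P.subset by (intro homI) (auto simp: carrier_FactGroup)
qed

text \<open>
  The subgroup \<open>A\<close> collects what earlier layers of the power series already contribute to
  \<open>H \<inter> P\<close>; the inequality is the telescoping invariant, stated with orders in place of ranks.
\<close>

lemma subgroup_generators_modulo:
  fixes G (structure)
  assumes G: "p_group p G" and p: "Factorial_Ring.prime p" "odd p" and H: "subgroup H G"
    and "P \<lhd> G" "commutes_mod G (pow_generate G p P) P (carrier G)"
    and "subgroup A G" "A \<subseteq> H \<inter> P"
  shows "\<exists>S. finite S \<and> S \<subseteq> H \<inter> P \<and> H \<inter> P \<subseteq> generate G (A \<union> S) \<and>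
    p ^ card S * card ((#>) (pow_generate G p P) ` A) \<le> card ((#>) (pow_generate G p P) ` P)"
  using assms(5-8)
proof (induction "card P" arbitrary: P A rule: less_induct)
  case less
  interpret group G using G by (simp add: p_group_def)
  interpret P: normal P G by fact
  have fin: "finite (carrier G)" using G by (simp add: p_group_def)
  have finP: "finite P" using finite_subset[OF P.subset fin] .
  define P1 where "P1 = pow_generate G p P"
  define P2 where "P2 = pow_generate G p P1"
  have P1: "P1 \<lhd> G" unfolding P1_def by (rule pow_generate_normal[OF less.prems(1)])
  have P2: "P2 \<lhd> G" unfolding P2_def by (rule pow_generate_normal[OF P1])
  interpret P1: normal P1 G by fact
  interpret P2: normal P2 G by fact
  have P1P: "P1 \<subseteq> P" unfolding P1_def by (rule pow_generate_subset[OF P.subgroup_axioms])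
  show ?case
  proof (cases "P = {\<one>}")
    case True
    have "card ((#>) P1 ` A) \<le> card ((#>) P1 ` P)"
      using less.prems(4) finP by (intro card_mono image_mono) auto
    then show ?thesis
      using True by (intro exI[of _ "{}"]) (auto simp: P1_def intro: generate.one)
  next
    case False
    then have "{\<one>} \<subset> P" using P.one_closed by blast
    \<comment> \<open>A proper normal subgroup containing all p-th powers of P shows P^p < P, which
      is the descent for the induction on the order of P.\<close>
    from exists_chief_subgroup[OF G p(1) one_is_normal less.prems(1) this]
    obtain M where M: "M \<lhd> G" "M \<subset> P" and PM: "\<And>x. x \<in> P \<Longrightarrow> x [^] p \<in> M" by metis
    have "P1 \<subseteq> M"
      unfolding P1_def pow_generate_def using PM M(1)
      by (intro generate_subgroup_incl normal_imp_subgroup) auto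
    then have "P1 \<subset> P" using M(2) by blast
    then have lt: "card P1 < card P" using finP by (rule psubset_card_mono[rotated])
    have comm0: "commutes_mod G P1 P (carrier G)" using less.prems(2) by (simp add: P1_def)
    have comm1: "commutes_mod G P2 P1 (carrier G)"
      unfolding P2_def
    proof (rule pow_generate_commutes[OF G p P1 P.subset comm0])
      show "P1 \<subseteq> generate G ((\<lambda>x. x [^] p) ` P \<union> group_center G)"
        unfolding P1_def pow_generate_def by (rule mono_generate) auto
    qed
    have HP: "subgroup (H \<inter> P) G" by (rule subgroups_Inter_pair[OF H P.subgroup_axioms])
    obtain T where T: "finite T" "T \<subseteq> H \<inter> P" "p ^ card T * card ((#>) P1 ` A) \<le> card ((#>) P1 ` (H \<inter> P))"
      "(#>) P1 ` generate G (A \<union> T) = (#>) P1 ` (H \<inter> P)"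
      "H \<inter> P \<subseteq> generate G (A \<union> T \<union> (H \<inter> P \<inter> P1))"
      using extend_generators_mod[OF G p(1) P1 less.prems(3) HP less.prems(4)] .
    let ?A = "generate G (A \<union> T)"
    have AT: "A \<union> T \<subseteq> H \<inter> P" using less.prems(4) T(2) by blast
    then have ATG: "A \<union> T \<subseteq> carrier G" using P.subset by blast
    have A': "subgroup ?A G" by (rule generate_is_subgroup[OF ATG])
    have A'HP: "?A \<subseteq> H \<inter> P" by (rule generate_subgroup_incl[OF AT HP])
    have A'': "subgroup (?A \<inter> P1) G" by (rule subgroups_Inter_pair[OF A' P1.subgroup_axioms])
    \<comment> \<open>The induction hypothesis for P1 = P^p, where the part of \<open>?A\<close>
      inside P1 counts as already available; it contains the p-th powers of the elements of
      \<open>?A\<close>.\<close>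
    have "\<exists>S. finite S \<and> S \<subseteq> H \<inter> P1 \<and> H \<inter> P1 \<subseteq> generate G (?A \<inter> P1 \<union> S) \<and>
      p ^ card S * card ((#>) P2 ` (?A \<inter> P1)) \<le> card ((#>) P2 ` P1)"
      using less.hyps[OF lt P1 _ A''] comm1 A'HP unfolding P2_def by blast
    then obtain S where S: "finite S" "S \<subseteq> H \<inter> P1" "H \<inter> P1 \<subseteq> generate G (?A \<inter> P1 \<union> S)"
      "p ^ card S * card ((#>) P2 ` (?A \<inter> P1)) \<le> card ((#>) P2 ` P1)" by blast
    \<comment> \<open>This map kills P1, and its image covers P1/P2 because P1 is generated by p-th
      powers from P; it is the epimorphism from P/P1 to P1/P2.\<close>
    let ?\<phi> = "\<lambda>x. P2 #> x [^] p"
    have \<phi>: "?\<phi> \<in> hom (G\<lparr>carrier := P\<rparr>) (G Mod P2)"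
      using pow_in_pow_generate[of _ P1 G p]
      by (intro pow_hom_mod[OF is_group less.prems(1) P1 P2 p(2) comm0 comm1]) (simp add: P2_def)
    interpret Q: group_hom G "G Mod P2" "(#>) P2" by (rule P2.group_hom_rcos)
    interpret GP: group "G\<lparr>carrier := P\<rparr>" by (rule subgroup_imp_group[OF P.subgroup_axioms])
    interpret P1P: normal P1 "G\<lparr>carrier := P\<rparr>"
      using normal_restrict_supergroup[OF P.subgroup_axioms P1 P1P] .
    interpret \<phi>: group_hom "G\<lparr>carrier := P\<rparr>" "G Mod P2" ?\<phi>
      using \<phi> P2.factorgroup_is_group by (intro group_hom.intro group_hom_axioms.intro) auto
    have "subgroup ?A (G\<lparr>carrier := P\<rparr>)"
      using A' A'HP by (intro subgroup_incl P.subgroup_axioms) auto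
    then have "card ((#>) P1 ` ?A) * card (?\<phi> ` P) \<le> card (?\<phi> ` ?A) * card ((#>) P1 ` P)"
      using P1P.card_cosets_image_le[of ?\<phi> "G Mod P2" ?A] finP \<phi> P2.factorgroup_is_group
        P2.rcos_eq_one_iff pow_in_pow_generate[of _ P1 G p] P2.subset
      by (auto simp: P2_def)
    moreover have "card (?\<phi> ` ?A) \<le> card ((#>) P2 ` (?A \<inter> P1))"
    proof (rule card_mono)
      show "finite ((#>) P2 ` (?A \<inter> P1))"
        using finite_subset[OF P1.subset fin] by blast
      have "x [^] p \<in> ?A \<inter> P1" if "x \<in> ?A" for x
        using that A'HP subgroup_nat_pow_closed[OF A'] pow_in_pow_generate[of x P G p]
        by (auto simp: P1_def)
      then show "?\<phi> ` ?A \<subseteq> (#>) P2 ` (?A \<inter> P1)" by blast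
    qed
    moreover have "card ((#>) P2 ` P1) \<le> card (?\<phi> ` P)"
    proof (rule card_mono)
      show "finite (?\<phi> ` P)" using finP by blast
      have "(\<lambda>x. x [^] p) ` P \<subseteq> carrier G" using P.subset by auto
      then have "(#>) P2 ` P1 = generate (G Mod P2) ((#>) P2 ` (\<lambda>x. x [^] p) ` P)"
        unfolding P1_def pow_generate_def using Q.generate_img by blast
      also have "\<dots> \<subseteq> ?\<phi> ` P"
        using \<phi>.img_is_subgroup by (intro Q.H.generate_subgroup_incl) (auto simp: image_image)
      finally show "(#>) P2 ` P1 \<subseteq> ?\<phi> ` P" .
    qed
    \<comment> \<open>In terms of indices: \<open>?A \<inter> P1\<close> has in P1/P2 at most the
      index that \<open>?A\<close> has in P/P1. What is missing in the next layer is bounded by what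
      is missing in this one.\<close>
    ultimately have key: "card ((#>) P1 ` ?A) * card ((#>) P2 ` P1) \<le> card ((#>) P2 ` (?A \<inter> P1)) * card ((#>) P1 ` P)"
      by (meson le_trans mult_le_mono1 mult_le_mono2)
    let ?a = "card ((#>) P1 ` A)" and ?b = "card ((#>) P2 ` P1)" and ?c = "card ((#>) P2 ` (?A \<inter> P1))"
      and ?d = "card ((#>) P1 ` P)" and ?e = "card ((#>) P1 ` ?A)"
    \<comment> \<open>The power of p for T is at most \<open>?e\<close> / \<open>?a\<close> and the
      one for S at most \<open>?b\<close> / \<open>?c\<close>, while \<open>key\<close> gives
      \<open>?e * ?b\<close> \<le> \<open>?c * ?d\<close>. Everything is multiplied through by the
      positive number \<open>?b\<close>, which is cancelled afterwards.\<close>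
    have "(p ^ (card T + card S) * ?a) * ?b = p ^ card S * (p ^ card T * ?a) * ?b"
      by (simp add: power_add mult_ac)
    also have "\<dots> \<le> p ^ card S * ?e * ?b" using T(3,4) by (intro mult_le_mono) auto
    also have "\<dots> \<le> p ^ card S * (?c * ?d)" using key by (simp add: mult.assoc)
    also have "\<dots> = (p ^ card S * ?c) * ?d" by simp
    also have "\<dots> \<le> ?b * ?d" using S(4) by (rule mult_le_mono1)
    finally have "(p ^ (card T + card S) * ?a) * ?b \<le> ?d * ?b" by (simp add: mult.commute)
    moreover have "?b > 0"
      using P1.one_closed finite_subset[OF P1.subset fin] by (metis card_gt_0_iff empty_iff finite_imageI imageI)
    ultimately have "p ^ (card T + card S) * ?a \<le> ?d" by simp
    moreover have "p ^ card (T \<union> S) \<le> p ^ (card T + card S)"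
      using card_Un_le[of T S] prime_gt_0_nat[OF p(1)] by (intro power_increasing) auto
    ultimately have "p ^ card (T \<union> S) * ?a \<le> ?d" by (meson le_trans mult_le_mono1)
    moreover have "H \<inter> P \<subseteq> generate G (A \<union> (T \<union> S))"
    proof -
      let ?B = "generate G (A \<union> (T \<union> S))"
      have B: "subgroup ?B G" using ATG S(2) P1.subset by (intro generate_is_subgroup) auto
      have sub: "A \<union> (T \<union> S) \<subseteq> ?B" by (auto intro: generate.incl)
      have "?A \<subseteq> ?B" by (rule mono_generate) auto
      then have "generate G (?A \<inter> P1 \<union> S) \<subseteq> ?B"
        using sub by (intro generate_subgroup_incl B) auto
      then have "H \<inter> P1 \<subseteq> ?B" using S(3) by blast
      then have "generate G (A \<union> T \<union> (H \<inter> P \<inter> P1)) \<subseteq> ?B"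
        using sub by (intro generate_subgroup_incl B) auto
      then show ?thesis using T(5) by blast
    qed
    ultimately show ?thesis
      using S(1,2) T(1,2) P1P unfolding P1_def by (intro exI[of _ "T \<union> S"]) blast
  qed
qed

section \<open>From the order of the top layer to numbers of generators\<close>

text \<open>Adjoining y to Y multiplies the order by at most p, since every element takes the form
  y^i h with i < p and h generated by Y.\<close>

lemma (in group) card_generate_commuting_le:
  assumes "finite Y" "0 < p" "Y \<subseteq> carrier G" "\<And>x y. x \<in> Y \<Longrightarrow> y \<in> Y \<Longrightarrow> x \<otimes> y = y \<otimes> x"
    and "\<And>y. y \<in> Y \<Longrightarrow> y [^] (p::nat) = \<one>"
  shows "finite (generate G Y) \<and> card (generate G Y) \<le> p ^ card Y"
  using assms
proof (induction Y rule: finite_induct)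
  case empty
  then show ?case by (simp add: generate_empty)
next
  case (insert y Y)
  have y: "y \<in> carrier G" and Y: "Y \<subseteq> carrier G" and yp: "y [^] p = \<one>"
    using insert.prems by auto
  have IH: "finite (generate G Y)" "card (generate G Y) \<le> p ^ card Y"
    using insert.IH insert.prems by auto
  define R where "R = (\<lambda>(i, h). y [^] i \<otimes> h) ` ({..<p} \<times> generate G Y)"
  have R: "y [^] i \<otimes> h \<in> R" if "h \<in> generate G Y" for i :: nat and h
  proof -
    have "y [^] i = y [^] (p * (i div p) + i mod p)" by simp
    also have "\<dots> = (y [^] p) [^] (i div p) \<otimes> y [^] (i mod p)"
      using y by (simp only: nat_pow_pow nat_pow_mult)
    also have "\<dots> = y [^] (i mod p)" using y yp by simp
    finally show ?thesis using that \<open>0 < p\<close> by (force simp: R_def)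
  qed
  have R0: "h \<in> R" if "h \<in> generate G Y" for h
    using R[OF that, of 0] generate_in_carrier[OF Y that] by simp
  have R1: "y [^] i \<in> R" for i :: nat
    using R[OF generate.one, of i] y by simp
  have "generate G (insert y Y) \<subseteq> R"
  proof
    fix x assume "x \<in> generate G (insert y Y)"
    then show "x \<in> R"
    proof (induction x rule: generate.induct)
      case one
      then show ?case by (rule R0[OF generate.one])
    next
      case (incl h)
      then show ?case using R0[OF generate.incl, of h] R1[of 1] y by auto
    next
      case (inv h)
      show ?case
      proof (cases "h = y")
        case True
        have "y [^] (p - 1) \<otimes> y = \<one>" using yp \<open>0 < p\<close> by (cases p) auto
        then have "inv y = y [^] (p - 1)" using y by (intro inv_equality) auto
        then show ?thesis using True R1[of "p - 1"] by simp
      next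
        case False
        then show ?thesis using inv R0[OF generate.inv] by blast
      qed
    next
      case (eng a b)
      then obtain i j :: nat and h k where a: "a = y [^] i \<otimes> h" "h \<in> generate G Y"
        and b: "b = y [^] j \<otimes> k" "k \<in> generate G Y"
        unfolding R_def by auto
      have hk: "h \<in> carrier G" "k \<in> carrier G" using a b generate_in_carrier[OF Y] by auto
      have "y \<otimes> h = h \<otimes> y"
        using generate_commutes[OF Y y _ a(2)] insert.prems by auto
      then have "y [^] j \<otimes> h = h \<otimes> y [^] j" using y hk by (intro group_commutes_pow)
      have "a \<otimes> b = y [^] i \<otimes> (h \<otimes> y [^] j) \<otimes> k"
        using a b hk y by (simp add: m_assoc)
      also have "\<dots> = y [^] i \<otimes> (y [^] j \<otimes> h) \<otimes> k"
        using \<open>y [^] j \<otimes> h = h \<otimes> y [^] j\<close> by simp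
      also have "\<dots> = (y [^] i \<otimes> y [^] j) \<otimes> (h \<otimes> k)" using hk y by (simp only: m_assoc m_closed nat_pow_closed)
      finally have "a \<otimes> b = y [^] (i + j) \<otimes> (h \<otimes> k)" using y by (simp add: nat_pow_mult)
      then show ?case using R[OF generate.eng[OF a(2) b(2)]] by simp
    qed
  qed
  moreover have "finite R" using IH(1) by (simp add: R_def)
  moreover have "card R \<le> p ^ card (insert y Y)"
  proof -
    have "card R \<le> p * card (generate G Y)"
      unfolding R_def using card_image_le[of "{..<p} \<times> generate G Y"] IH(1)
      by (simp add: card_cartesian_product)
    also have "\<dots> \<le> p * p ^ card Y" using IH(2) by (rule mult_le_mono2)
    finally show ?thesis using insert.hyps by simp
  qed
  ultimately show ?case
    using card_mono[of R "generate G (insert y Y)"] finite_subset by fastforce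
qed

text \<open>The cosets of the elements of Y commute and have order dividing p, and the subgroup they
  generate in G/H contains the image of P.\<close>

lemma (in normal) card_cosets_le:
  assumes "0 < (p::nat)" "finite Y" "Y \<subseteq> P" "P \<subseteq> generate G (Y \<union> H)"
    and PG: "P \<subseteq> carrier G" and comm: "commutes_mod G H P P" and pow: "\<And>x. x \<in> P \<Longrightarrow> x [^] p \<in> H"
  shows "card ((#>) H ` P) \<le> p ^ card Y"
proof -
  interpret Q: group_hom G "G Mod H" "(#>) H" by (rule group_hom_rcos)
  let ?gen = "generate (G Mod H) ((#>) H ` Y)"
  have YG: "Y \<subseteq> carrier G" using assms(3) PG by blast
  then have fYG: "(#>) H ` Y \<subseteq> carrier (G Mod H)" by auto
  have "finite ?gen \<and> card ?gen \<le> p ^ card ((#>) H ` Y)"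
  proof (rule Q.H.card_generate_commuting_le[OF _ assms(1) fYG])
    show "finite ((#>) H ` Y)" using assms(2) by simp
    fix c assume "c \<in> (#>) H ` Y"
    then obtain a where a: "a \<in> Y" "c = H #> a" by blast
    then show "c [^]\<^bsub>G Mod H\<^esub> p = \<one>\<^bsub>G Mod H\<^esub>"
      using pow_mem_iff[of a p] pow[of a] assms(3) YG by blast
    fix d assume "d \<in> (#>) H ` Y"
    then obtain b where b: "b \<in> Y" "d = H #> b" by blast
    show "c \<otimes>\<^bsub>G Mod H\<^esub> d = d \<otimes>\<^bsub>G Mod H\<^esub> c"
      using rcos_commute_iff[of a b] commutes_modD[OF comm, of a b] a b assms(3) YG by blast
  qed
  moreover have "(#>) H ` P \<subseteq> ?gen"
  proof -
    have "(#>) H ` P \<subseteq> (#>) H ` generate G (Y \<union> H)" using assms(4) by blast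
    also have "\<dots> = generate (G Mod H) ((#>) H ` (Y \<union> H))"
      using YG subset by (intro Q.generate_img [symmetric]) auto
    also have "\<dots> \<subseteq> ?gen"
    proof (rule Q.H.generate_subgroup_incl[OF _ Q.H.generate_is_subgroup[OF fYG]])
      have "H #> x \<in> ?gen" if "x \<in> H" for x
        using that rcos_eq_one_iff[of x] generate.one[of "G Mod H" "(#>) H ` Y"] subset
        by (metis subsetD)
      then show "(#>) H ` (Y \<union> H) \<subseteq> ?gen"
        by (auto intro: generate.incl)
    qed
    finally show ?thesis .
  qed
  ultimately have "card ((#>) H ` P) \<le> p ^ card ((#>) H ` Y)"
    using card_mono[of ?gen "(#>) H ` P"] by linarith
  also have "\<dots> \<le> p ^ card Y"
    using assms(1,2) by (intro power_increasing card_image_le) auto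
  finally show ?thesis .
qed

text \<open>The telescoping estimate with trivial A gives p^|S| \<le> |P/P^p|. As P/P^p is
  elementary abelian and generated by the image of Y, its order is at most p^|Y|; comparing
  exponents finishes the argument.\<close>

lemma subgroup_generators_le:
  fixes G (structure)
  assumes G: "p_group p G" and p: "Factorial_Ring.prime p" "odd p" and H: "subgroup H G"
    and P: "P \<lhd> G" "commutes_mod G (pow_generate G p P) P (carrier G)"
    and Y: "finite Y" "Y \<subseteq> P" "P \<subseteq> generate G (Y \<union> pow_generate G p P)"
  obtains S where "finite S" "S \<subseteq> H \<inter> P" "card S \<le> card Y" "generate G S = H \<inter> P"
proof -
  interpret group G using G by (simp add: p_group_def)
  interpret P: normal P G by fact
  interpret H: subgroup H G by fact
  let ?K = "pow_generate G p P"
  interpret K: normal ?K G by (rule pow_generate_normal[OF P(1)])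
  have p1: "1 < p" using p(1) by (rule prime_gt_1_nat)
  have "{\<one>} \<subseteq> H \<inter> P" using P.one_closed H.one_closed by simp
  from subgroup_generators_modulo[OF G p H P triv_subgroup this]
  obtain S where S: "finite S" "S \<subseteq> H \<inter> P" "H \<inter> P \<subseteq> generate G ({\<one>} \<union> S)"
    "p ^ card S * card ((#>) ?K ` {\<one>}) \<le> card ((#>) ?K ` P)" by blast
  have "card ((#>) ?K ` P) \<le> p ^ card Y"
    using p1 P.subset P(2) pow_in_pow_generate[of _ P G p]
    by (intro K.card_cosets_le Y) (auto intro: commutes_mod_mono)
  then have "p ^ card S \<le> p ^ card Y" using S(4) by simp
  then have "card S \<le> card Y" using p1 by simp
  moreover have "generate G S = H \<inter> P"
  proof
    have HP: "subgroup (H \<inter> P) G" by (rule subgroups_Inter_pair[OF H P.subgroup_axioms])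
    show "generate G S \<subseteq> H \<inter> P" by (rule generate_subgroup_incl[OF S(2) HP])
    have "S \<subseteq> carrier G" using S(2) P.subset by blast
    then have "generate G ({\<one>} \<union> S) \<subseteq> generate G S"
      by (intro generate_subgroup_incl generate_is_subgroup) (auto intro: generate.one generate.incl)
    then show "H \<inter> P \<subseteq> generate G S" using S(3) by blast
  qed
  ultimately show thesis using that S(1,2) by blast
qed

text \<open>Powerfulness of G/N says that the whole group G/N satisfies the commutator condition of
  \<open>subgroup_generators_le\<close>. That lemma is applied to the image of H, and the resulting
  cosets are represented by elements of H.\<close>

lemma subgroup_generators_powerful_quotient:
  fixes G (structure)
  assumes G: "p_group p G" and p: "Factorial_Ring.prime p" "odd p" and H: "subgroup H G"
    and N: "N \<lhd> G" and pow: "powerful p (G Mod N)"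
    and Y: "finite Y" "Y \<subseteq> carrier G" "generate G Y = carrier G"
  obtains S where "finite S" "S \<subseteq> H" "card S \<le> card Y" "H \<subseteq> generate G (S \<union> (H \<inter> N))"
proof -
  interpret group G using G by (simp add: p_group_def)
  interpret N: normal N G by fact
  interpret Q: group_hom G "G Mod N" "(#>) N" by (rule N.group_hom_rcos)
  interpret H: subgroup H G by fact
  let ?Q = "G Mod N"
  let ?Y = "(#>) N ` Y"
  have carr: "carrier ?Q = (#>) N ` carrier G" by (simp add: carrier_FactGroup)
  have "commutes_mod ?Q (pow_generate ?Q p (carrier ?Q)) (carrier ?Q) (carrier ?Q)"
    using pow unfolding powerful_def pow_subgroup_eq derived_def
    by (intro commutes_modI) (auto intro!: generate.incl)
  moreover have "generate ?Q ?Y = carrier ?Q" using Q.generate_img[OF Y(2)] Y(3) carr by simp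
  then have "carrier ?Q \<subseteq> generate ?Q (?Y \<union> pow_generate ?Q p (carrier ?Q))"
    using Q.H.mono_generate[of ?Y "?Y \<union> pow_generate ?Q p (carrier ?Q)"] by auto
  moreover have "finite ?Y" "?Y \<subseteq> carrier ?Q" using Y(1,2) carr by auto
  ultimately obtain S where S: "finite S" "S \<subseteq> (#>) N ` H \<inter> carrier ?Q" "card S \<le> card ?Y"
      "generate ?Q S = (#>) N ` H \<inter> carrier ?Q"
    using subgroup_generators_le[OF p_group_Mod[OF G p(1) N] p Q.subgroup_img_is_subgroup[OF H]
        Q.H.normal_self, of ?Y] by metis
  have HQ: "(#>) N ` H \<inter> carrier ?Q = (#>) N ` H" using H.subset carr by blast
  obtain T where T: "T \<subseteq> H" "inj_on ((#>) N) T" "S = (#>) N ` T"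
    using S(2) unfolding HQ by (metis subset_image_inj)
  have "(#>) N ` H \<subseteq> (#>) N ` generate G T"
    using Q.generate_img[of T] S(4) T H.subset unfolding HQ by auto
  then have "H \<subseteq> generate G (T \<union> (H \<inter> N))"
    by (rule N.subset_generate_mod[OF T(1) H order_refl])
  moreover have "finite T" "card T = card S" using T S(1) by (auto simp: finite_image_iff card_image)
  moreover have "card ?Y \<le> card Y" by (rule card_image_le[OF Y(1)])
  ultimately show thesis using that[of T] T(1) S(3) by simp
qed

text \<open>Commuting is symmetric, so one orientation per unordered pair of generators suffices.
  The bound is n(n - 1)/2 without subtraction or division; a new element contributes its pairs with
  all earlier ones.\<close>

lemma exists_half_pairs:
  assumes "finite Y"
  shows "\<exists>C. finite C \<and> C \<subseteq> Y \<times> Y \<and> 2 * card C + card Y \<le> card Y * card Y \<and>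
    (\<forall>x\<in>Y. \<forall>y\<in>Y. x \<noteq> y \<longrightarrow> (x, y) \<in> C \<or> (y, x) \<in> C)"
  using assms
proof (induction Y rule: finite_induct)
  case (insert y Y)
  then obtain C where C: "finite C" "C \<subseteq> Y \<times> Y" "2 * card C + card Y \<le> card Y * card Y"
    "\<forall>x\<in>Y. \<forall>y\<in>Y. x \<noteq> y \<longrightarrow> (x, y) \<in> C \<or> (y, x) \<in> C" by blast
  let ?C = "C \<union> {y} \<times> Y"
  have "card ?C \<le> card C + card Y"
    using card_Un_le[of C "{y} \<times> Y"] by (simp add: card_cartesian_product_singleton)
  then have "2 * card ?C + card (insert y Y) \<le> card (insert y Y) * card (insert y Y)"
    using C(3) insert.hyps by simp
  then show ?case using C insert.hyps by (intro exI[of _ ?C]) auto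
qed auto

subsection \<open>Quasi-powerful groups\<close>

text \<open>Let Q be generated by K and the selected commutators. The derived subgroup is central
  modulo K, so Q is normal in G; modulo Q the generators Y commute pairwise, hence G/Q is abelian
  and Q contains the derived subgroup.\<close>

lemma derived_generators:
  fixes G (structure)
  assumes "group G" and Y: "finite Y" "Y \<subseteq> carrier G" "generate G Y = carrier G"
    and K: "K \<lhd> G" "K \<subseteq> derived G (carrier G)"
      "commutes_mod G K (derived G (carrier G)) (carrier G)"
  obtains C where "finite C" "C \<subseteq> derived G (carrier G)" "2 * card C + card Y \<le> card Y * card Y"
    "derived G (carrier G) \<subseteq> generate G (C \<union> K)"
proof -
  interpret group G by fact
  interpret K: normal K G by fact
  let ?D = "derived G (carrier G)"
  interpret D: normal ?D G by (rule derived_self_is_normal)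
  obtain C where C: "finite C" "C \<subseteq> Y \<times> Y" "2 * card C + card Y \<le> card Y * card Y"
    "\<And>x y. x \<in> Y \<Longrightarrow> y \<in> Y \<Longrightarrow> x \<noteq> y \<Longrightarrow> (x, y) \<in> C \<or> (y, x) \<in> C"
    using exists_half_pairs[OF Y(1)] by metis
  let ?com = "\<lambda>(x, y). x \<otimes> y \<otimes> inv x \<otimes> inv y"
  let ?Q = "generate G (?com ` C \<union> K)"
  have CD: "?com ` C \<subseteq> ?D"
  proof
    fix c assume "c \<in> ?com ` C"
    then obtain x y where "x \<in> carrier G" "y \<in> carrier G" "c = x \<otimes> y \<otimes> inv x \<otimes> inv y"
      using C(2) Y(2) by auto
    then show "c \<in> ?D" unfolding derived_def by (intro generate.incl) blast
  qed
  have sub: "?com ` C \<union> K \<subseteq> ?D" using CD K(2) by blast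
  have QD: "?Q \<subseteq> ?D" by (rule generate_subgroup_incl[OF sub D.subgroup_axioms])
  have subG: "?com ` C \<union> K \<subseteq> carrier G" using sub D.subset by blast
  have KQ: "K \<subseteq> ?Q" by (auto intro: generate.incl)
  have Qsub: "subgroup ?Q G" by (rule generate_is_subgroup[OF subG])
  have "?Q \<lhd> G"
  proof (rule normal_invI[OF Qsub])
    fix g q assume g: "g \<in> carrier G" and q: "q \<in> ?Q"
    have qG: "q \<in> carrier G" using generate_in_carrier[OF subG q] .
    have "g \<otimes> q \<otimes> inv g \<otimes> inv q \<in> ?Q"
      using commutes_modD[OF K.commutes_mod_sym[OF D.subset order_refl K(3)] g] q QD KQ by blast
    then have "g \<otimes> q \<otimes> inv g \<otimes> inv q \<otimes> q \<in> ?Q" using q by (rule generate.eng)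
    then show "g \<otimes> q \<otimes> inv g \<in> ?Q" using g qG by (simp add: m_assoc)
  qed
  then interpret Q: normal ?Q G .
  have "commutes_mod G ?Q Y Y"
  proof (rule commutes_modI)
    fix x y assume xy: "x \<in> Y" "y \<in> Y"
    then have G: "x \<in> carrier G" "y \<in> carrier G" using Y by auto
    have *: "a \<otimes> b \<otimes> inv a \<otimes> inv b \<in> ?Q" if "(a, b) \<in> C" for a b
      using that by (intro generate.incl) force
    consider "x = y" | "(x, y) \<in> C" | "(y, x) \<in> C" using C(4)[OF xy] by blast
    then show "x \<otimes> y \<otimes> inv x \<otimes> inv y \<in> ?Q"
    proof cases
      case 1
      then show ?thesis using Q.rcos_commute_iff[OF G] by metis
    next
      case 2
      then show ?thesis by (rule *)
    next
      case 3
      then show ?thesis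
        using *[OF 3] Q.rcos_commute_iff[OF G] Q.rcos_commute_iff[OF G(2,1)] by metis
    qed
  qed
  from Q.commutes_mod_generate[OF Y(2) Y(2) this]
  have "commutes_mod G ?Q Y (carrier G)"
    using Q.commutes_mod_sym[OF order_refl Y(2)] Y(3) by simp
  from Q.commutes_mod_generate[OF Y(2) order_refl this]
  have "commutes_mod G ?Q (carrier G) (carrier G)" using Y(3) by simp
  then have "?D \<subseteq> ?Q"
    unfolding derived_def
    by (intro generate_subgroup_incl Qsub) (auto simp: commutes_mod_def)
  moreover have "card (?com ` C) \<le> card C" by (rule card_image_le[OF C(1)])
  ultimately show thesis
    using that[of "?com ` C"] C(1,3) CD by simp
qed

text \<open>Pulled back to G, powerfulness of G/Z reads [G, G] \<le> G^p Z. This is the generation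
  hypothesis of \<open>pow_generate_commutes\<close> for M = [G, G] and A = G.\<close>

lemma quasi_powerful_derived:
  fixes G (structure)
  assumes qp: "quasi_powerful p G" and p: "Factorial_Ring.prime p" "odd p"
  shows "commutes_mod G (pow_generate G p (derived G (carrier G))) (derived G (carrier G)) (carrier G)"
proof -
  have G: "p_group p G" and pow: "powerful p (G Mod group_center G)"
    using qp by (auto simp: quasi_powerful_def)
  interpret group G using G by (simp add: p_group_def)
  interpret Z: normal "group_center G" G by (rule center_normal)
  let ?Q = "G Mod group_center G" and ?D = "derived G (carrier G)" and ?f = "(#>) (group_center G)"
  interpret Q: group_hom G ?Q ?f by (rule Z.group_hom_rcos)
  let ?A = "(\<lambda>x. x [^] p) ` carrier G"
  have A: "?A \<subseteq> carrier G" by auto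
  have carr: "carrier ?Q = ?f ` carrier G" by (simp add: carrier_FactGroup)
  have "?f ` ?D = derived ?Q (carrier ?Q)"
    using Q.derived_img[of "carrier G"] carr by simp
  also have "\<dots> \<subseteq> pow_generate ?Q p (carrier ?Q)"
    using pow by (simp add: powerful_def pow_subgroup_eq)
  also have "\<dots> = generate ?Q (?f ` ?A)"
    unfolding pow_generate_def carr image_image by (simp add: Z.FactGroup_pow cong: image_cong)
  also have "\<dots> = ?f ` generate G ?A" by (rule Q.generate_img[OF A])
  finally have "?D \<subseteq> generate G (?A \<union> (carrier G \<inter> group_center G))"
    using derived_in_carrier[of "carrier G"] by (intro Z.subset_generate_mod A subgroup_self) auto
  moreover have "carrier G \<inter> group_center G = group_center G" using Z.subset by blast
  moreover have "commutes_mod G ?D (carrier G) (carrier G)"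
    unfolding derived_def by (intro commutes_modI generate.incl) blast
  ultimately show ?thesis
    using derived_self_is_normal by (intro pow_generate_commutes[OF G p _ order_refl]) auto
qed

section \<open>Minimal numbers of generators and the final count\<close>

lemma min_gens_le:
  assumes "group G" "subgroup L G" "finite S" "S \<subseteq> L" "generate G S = L"
  shows "min_gens (G\<lparr>carrier := L\<rparr>) \<le> card S"
  unfolding min_gens_def
  using assms group.generate_consistent[OF assms(1,4,2)] by (intro Least_le) auto

text \<open>Ensures that the \<open>LEAST\<close> in \<open>min_gens\<close> is a genuine minimum: a
  finite group is generated by its own carrier.\<close>

lemma min_gens_attained:
  assumes "group G" "finite (carrier G)"
  obtains Y where "finite Y" "Y \<subseteq> carrier G" "card Y = min_gens G" "generate G Y = carrier G"
proof -
  let ?P = "\<lambda>n. \<exists>S. S \<subseteq> carrier G \<and> finite S \<and> card S = n \<and> generate G S = carrier G"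
  have "generate G (carrier G) = carrier G"
    using group.generate_incl[OF assms(1) order_refl] by (auto intro: generate.incl)
  then have "?P (card (carrier G))" using assms(2) by blast
  then have "?P (min_gens G)" unfolding min_gens_def by (rule LeastI)
  then show thesis using that by blast
qed

theorem theorem6:
  fixes G :: "('a, 'b) monoid_scheme" and p r :: nat and L :: "'a set"
  assumes "Factorial_Ring.prime p" and "odd p"
    and "quasi_powerful p G"
    and "min_gens G = r"
    and "subgroup L G"
  shows "2 * min_gens (G\<lparr>carrier := L\<rparr>) \<le> r * (r + 3)"
proof -
  note p = assms(1,2) and L = assms(5)
  have G: "p_group p G" and powZ: "powerful p (G Mod group_center G)"
    using assms(3) by (auto simp: quasi_powerful_def)
  interpret group G using G by (simp add: p_group_def)
  let ?Z = "group_center G" and ?D = "derived G (carrier G)"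
  interpret Z: normal ?Z G by (rule center_normal)
  interpret D: normal ?D G by (rule derived_self_is_normal)
  have LZ: "subgroup (L \<inter> ?Z) G" by (rule subgroups_Inter_pair[OF L Z.subgroup_axioms])
  obtain Y where Y: "finite Y" "Y \<subseteq> carrier G" "generate G Y = carrier G" and r: "card Y = r"
    using min_gens_attained[OF is_group] G assms(4) by (metis p_group_def)
  \<comment> \<open>The section L/(L \<inter> Z), seen inside the powerful group G/Z.\<close>
  obtain S1 where S1: "finite S1" "S1 \<subseteq> L" "card S1 \<le> r" "L \<subseteq> generate G (S1 \<union> (L \<inter> ?Z))"
    using subgroup_generators_powerful_quotient[OF G p L Z.normal_axioms powZ Y] r by metis
  \<comment> \<open>An abelian p-group is powerful because its derived subgroup is trivial; this
    handles the section of L \<inter> Z modulo D.\<close>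
  have "powerful p (G Mod ?D)"
  proof -
    interpret A: comm_group "G Mod ?D" by (rule derived_quot_is_comm_group)
    have "derived (G Mod ?D) (carrier (G Mod ?D)) = {\<one>\<^bsub>G Mod ?D\<^esub>}"
      by (rule A.derived_eq_singleton[OF order_refl])
    then show ?thesis
      using p_group_Mod[OF G p(1) D.normal_axioms] generate.one[of "G Mod ?D"]
      by (simp add: powerful_def pow_subgroup_def)
  qed
  then obtain S2 where S2: "finite S2" "S2 \<subseteq> L \<inter> ?Z" "card S2 \<le> r"
      "L \<inter> ?Z \<subseteq> generate G (S2 \<union> (L \<inter> ?Z \<inter> ?D))"
    using subgroup_generators_powerful_quotient[OF G p LZ D.normal_axioms _ Y] r by metis
  have comm: "commutes_mod G (pow_generate G p ?D) ?D (carrier G)"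
    by (rule quasi_powerful_derived[OF assms(3) p])
  obtain C where C: "finite C" "C \<subseteq> ?D" "2 * card C + r \<le> r * r"
      "?D \<subseteq> generate G (C \<union> pow_generate G p ?D)"
    using derived_generators[OF is_group Y pow_generate_normal[OF D.normal_axioms]
        pow_generate_subset[OF D.subgroup_axioms] comm] r by metis
  \<comment> \<open>The last section is the subgroup L \<inter> Z \<inter> D of the powerfully
    embedded D, and C generates D modulo D^p.\<close>
  obtain S3 where S3: "finite S3" "S3 \<subseteq> L \<inter> ?Z \<inter> ?D" "card S3 \<le> card C"
      "generate G S3 = L \<inter> ?Z \<inter> ?D"
    using subgroup_generators_le[OF G p LZ D.normal_axioms comm C(1,2,4)] .
  let ?S = "S1 \<union> S2 \<union> S3"
  have SL: "?S \<subseteq> L" using S1(2) S2(2) S3(2) by blast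
  have "?S \<subseteq> carrier G" using SL subgroup.subset[OF L] by blast
  then have gS: "subgroup (generate G ?S) G" by (rule generate_is_subgroup)
  have "L \<subseteq> generate G ?S"
  proof -
    have sub: "?S \<subseteq> generate G ?S" by (auto intro: generate.incl)
    have "L \<inter> ?Z \<inter> ?D \<subseteq> generate G ?S"
      using mono_generate[of S3 ?S] S3(4) by auto
    then have "generate G (S2 \<union> (L \<inter> ?Z \<inter> ?D)) \<subseteq> generate G ?S"
      using sub by (intro generate_subgroup_incl gS) auto
    then have "L \<inter> ?Z \<subseteq> generate G ?S" using S2(4) by blast
    then have "generate G (S1 \<union> (L \<inter> ?Z)) \<subseteq> generate G ?S"
      using sub by (intro generate_subgroup_incl gS) auto
    then show ?thesis using S1(4) by blast
  qed
  then have "generate G ?S = L" using generate_subgroup_incl[OF SL L] by blast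
  then have "min_gens (G\<lparr>carrier := L\<rparr>) \<le> card ?S"
    using S1(1) S2(1) S3(1) SL by (intro min_gens_le is_group L) auto
  also have "card ?S \<le> card S1 + card S2 + card S3"
    using card_Un_le[of "S1 \<union> S2" S3] card_Un_le[of S1 S2] by linarith
  \<comment> \<open>Twice the total is at most 4r + 2|C| \<le> 4r + r^2 - r = r(r + 3).\<close>
  finally show ?thesis using S1(3) S2(3) S3(3) C(3) by (simp add: algebra_simps)
qed

end
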